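(* Let $d_1,d_2,a_i,b_i,c_i$ $(i=1,2)$ be positive constants with $a_1/a_2\neq b_1/b_2$ and $a_1/a_2\neq c_1/c_2$, and put $\delta:=d_1/d_2$, $d:=d_2$. Let $\{(u_n,v_n)\}$ be any sequence of positive nonconstant solutions of $$ \begin{cases} \Delta[(d_1+\alpha v)u]+f(u,v)=0 &\text{in }\Omega,\\ \Delta[(d_2+\beta u)v]+g(u,v)=0 &\text{in }\Omega,\\ \partial_\nu u=\partial_\nu v=0 &\text{on }\partial\Omega \end{cases} $$ with $\alpha=\alpha_n\to\infty$, $\beta=\beta_n\to\infty$ and $\alpha_n/\beta_n\to\gamma$ as $n\to\infty$ for some $\gamma>0$. Then the following situation cannot occur along any subsequence: there exist nonnegative functions $u,v\in C(\overline\Omega)$ with $uv=0$ in $\Omega$ such that $(u_n,v_n)\to(u,v)$ uniformly in $\overline\Omega$, and $w_n:=\delta u_n-\gamma v_n$ converges in $C^1(\overline\Omega)$ to some sign-changing function $w$ satisfying $$ \begin{cases} d\Delta w+f\bigl(\tfrac{w_{+}}{\delta},\tfrac{w_{-}}{\gamma}\bigr)-\gamma g\bigl(\tfrac{w_{+}}{\delta},\tfrac{w_{-}}{\gamma}\bigr)=0 &\text{in }\Omega,\\ \partial_\nu w=0 &\text{on }\partial\Omega,\\ \displaystyle\int_\Omega f\bigl(\tfrac{w_{+}}{\delta},\tfrac{w_{-}}{\gamma}\bigr)=0, \end{cases} $$ and $(u,v)=(w_+/\delta,\,w_-/\gamma)$.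
   Context: $\Omega\subset\mathbb{R}^N$ is a bounded domain with smooth boundary $\partial\Omega$ if $N\ge 2$, and a bounded open interval if $N=1$; $\nu$ is the outward unit normal and $\partial_\nu w=\nu\cdot\nabla w$. $f(u,v):=u(a_1-b_1u-c_1v)$ and $g(u,v):=v(a_2-b_2u-c_2v)$. $w_+:=\max\{w,0\}$ and $w_-:=-\min\{w,0\}\ge 0$. A positive solution $(u,v)$ is one with $u>0$ and $v>0$ in $\Omega$. Sign-changing means that $w$ takes both positive and negative values in $\Omega$. The equation for $w$ is understood in the weak (equivalently, $W^{2,p}(\Omega)$) sense. *)

theory Defs
  imports "HOL-Analysis.Analysis"
begin

section \<open>Derivatives on open sets\<close>

definition partial :: "'a::euclidean_space \<Rightarrow> ('a \<Rightarrow> real) \<Rightarrow> 'a \<Rightarrow> real" where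
  "partial b h x = frechet_derivative h (at x) b"

definition gradient :: "('a::euclidean_space \<Rightarrow> real) \<Rightarrow> 'a \<Rightarrow> 'a" where
  "gradient h x = (\<Sum>b\<in>Basis. partial b h x *\<^sub>R b)"

definition laplacian :: "('a::euclidean_space \<Rightarrow> real) \<Rightarrow> 'a \<Rightarrow> real" where
  "laplacian h x = (\<Sum>b\<in>Basis. partial b (partial b h) x)"

text \<open>The class $C^k(S)$; meant for open \<open>S\<close>, where the Frechet derivatives at points of \<open>S\<close>
  depend only on the values of \<open>h\<close> in \<open>S\<close>.\<close>

primrec Ck_on :: "nat \<Rightarrow> 'a::euclidean_space set \<Rightarrow> ('a \<Rightarrow> real) \<Rightarrow> bool" where
  "Ck_on 0 S h \<longleftrightarrow> continuous_on S h"
| "Ck_on (Suc k) S h \<longleftrightarrow>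
     (\<forall>x\<in>S. h differentiable (at x)) \<and> (\<forall>b\<in>Basis. Ck_on k S (partial b h))"

definition smooth_on :: "'a::euclidean_space set \<Rightarrow> ('a \<Rightarrow> real) \<Rightarrow> bool" where
  "smooth_on S h \<longleftrightarrow> (\<forall>k. Ck_on k S h)"


section \<open>Domains and their boundary\<close>

text \<open>\<open>\<rho>\<close> is a smooth local defining function of \<open>\<Omega>\<close> near \<open>p\<close>. By the implicit function theorem
  the boundary is then, near \<open>p\<close>, the smooth hypersurface \<open>\<rho> = 0\<close>, with \<open>\<Omega>\<close> on one side of it.\<close>

definition local_defining_function ::
    "'a::euclidean_space set \<Rightarrow> 'a \<Rightarrow> 'a set \<Rightarrow> ('a \<Rightarrow> real) \<Rightarrow> bool" where
  "local_defining_function \<Omega> p U \<rho> \<longleftrightarrow>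
     open U \<and> p \<in> U \<and> smooth_on U \<rho> \<and> (\<forall>x\<in>U. gradient \<rho> x \<noteq> 0) \<and> \<Omega> \<inter> U = {x\<in>U. \<rho> x < 0}"

definition smooth_boundary :: "'a::euclidean_space set \<Rightarrow> bool" where
  "smooth_boundary \<Omega> \<longleftrightarrow> (\<forall>p\<in>frontier \<Omega>. \<exists>U \<rho>. local_defining_function \<Omega> p U \<rho>)"

text \<open>In dimension one the first four conditions say exactly that \<open>\<Omega>\<close> is a bounded open interval.\<close>

definition bounded_smooth_domain :: "'a::euclidean_space set \<Rightarrow> bool" where
  "bounded_smooth_domain \<Omega> \<longleftrightarrow>
     open \<Omega> \<and> connected \<Omega> \<and> bounded \<Omega> \<and> \<Omega> \<noteq> {} \<and> (DIM('a) \<ge> 2 \<longrightarrow> smooth_boundary \<Omega>)"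

text \<open>The outward unit normal does not depend on the choice of the defining function. The endpoints
  of an interval have defining functions too (affine ones), so this also covers dimension one.\<close>

definition outward_unit_normal :: "'a::euclidean_space set \<Rightarrow> 'a \<Rightarrow> 'a \<Rightarrow> bool" where
  "outward_unit_normal \<Omega> p \<nu> \<longleftrightarrow>
     (\<exists>U \<rho>. local_defining_function \<Omega> p U \<rho> \<and> \<nu> = sgn (gradient \<rho> p))"


section \<open>Functions of class C1 up to the boundary\<close>

text \<open>\<open>h\<close> belongs to $C^1(\overline\Omega)$, and \<open>G\<close> is its gradient, extended continuously to the
  closure. On the closure of an open set, \<open>G\<close> is uniquely determined by \<open>h\<close>.\<close>

definition C1_closure_gradient ::
    "'a::euclidean_space set \<Rightarrow> ('a \<Rightarrow> real) \<Rightarrow> ('a \<Rightarrow> 'a) \<Rightarrow> bool" where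
  "C1_closure_gradient \<Omega> h G \<longleftrightarrow>
     continuous_on (closure \<Omega>) h \<and> continuous_on (closure \<Omega>) G \<and> (\<forall>x\<in>\<Omega>. GDERIV h x :> G x)"

text \<open>The boundary condition $\partial_\nu h = 0$, in terms of the extended gradient \<open>G\<close> of \<open>h\<close>.\<close>

definition neumann_condition :: "'a::euclidean_space set \<Rightarrow> ('a \<Rightarrow> 'a) \<Rightarrow> bool" where
  "neumann_condition \<Omega> G \<longleftrightarrow>
     (\<forall>p\<in>frontier \<Omega>. \<forall>\<nu>. outward_unit_normal \<Omega> p \<nu> \<longrightarrow> \<nu> \<bullet> G p = 0)"

definition C1_closure_limit ::
    "'a::euclidean_space set \<Rightarrow> (nat \<Rightarrow> 'a \<Rightarrow> real) \<Rightarrow> ('a \<Rightarrow> real) \<Rightarrow> bool" where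
  "C1_closure_limit \<Omega> hs h \<longleftrightarrow>
     (\<exists>Gs G. (\<forall>n. C1_closure_gradient \<Omega> (hs n) (Gs n)) \<and> C1_closure_gradient \<Omega> h G \<and>
        uniform_limit (closure \<Omega>) hs h sequentially \<and>
        uniform_limit (closure \<Omega>) Gs G sequentially)"

text \<open>\<open>h\<close> is a weak solution of $d\Delta h + F = 0$ in \<open>\<Omega>\<close> with $\partial_\nu h = 0$ on the boundary.\<close>

definition weak_neumann_solution ::
    "'a::euclidean_space set \<Rightarrow> real \<Rightarrow> ('a \<Rightarrow> real) \<Rightarrow> ('a \<Rightarrow> real) \<Rightarrow> bool" where
  "weak_neumann_solution \<Omega> d F h \<longleftrightarrow>
     (\<exists>G. C1_closure_gradient \<Omega> h G \<and> neumann_condition \<Omega> G \<and>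
        (\<forall>\<phi> \<Phi>. C1_closure_gradient \<Omega> \<phi> \<Phi> \<longrightarrow>
           d * (LINT x:\<Omega>|lborel. G x \<bullet> \<Phi> x) = (LINT x:\<Omega>|lborel. F x * \<phi> x)))"


section \<open>The cross-diffusion system\<close>

definition reaction_f :: "real \<Rightarrow> real \<Rightarrow> real \<Rightarrow> real \<Rightarrow> real \<Rightarrow> real" where
  "reaction_f a\<^sub>1 b\<^sub>1 c\<^sub>1 s t = s * (a\<^sub>1 - b\<^sub>1 * s - c\<^sub>1 * t)"

definition reaction_g :: "real \<Rightarrow> real \<Rightarrow> real \<Rightarrow> real \<Rightarrow> real \<Rightarrow> real" where
  "reaction_g a\<^sub>2 b\<^sub>2 c\<^sub>2 s t = t * (a\<^sub>2 - b\<^sub>2 * s - c\<^sub>2 * t)"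

text \<open>Classical solutions: \<open>u\<close> and \<open>v\<close> lie in $C^2(\Omega)\cap C^1(\overline\Omega)$.\<close>

definition cross_diffusion_solution ::
    "'a::euclidean_space set \<Rightarrow> real \<Rightarrow> real \<Rightarrow> real \<Rightarrow> real \<Rightarrow>
     (real \<Rightarrow> real \<Rightarrow> real) \<Rightarrow> (real \<Rightarrow> real \<Rightarrow> real) \<Rightarrow> ('a \<Rightarrow> real) \<Rightarrow> ('a \<Rightarrow> real) \<Rightarrow> bool" where
  "cross_diffusion_solution \<Omega> d\<^sub>1 d\<^sub>2 \<alpha> \<beta> f g u v \<longleftrightarrow>
     Ck_on 2 \<Omega> u \<and> Ck_on 2 \<Omega> v \<and>
     (\<forall>x\<in>\<Omega>. laplacian (\<lambda>y. (d\<^sub>1 + \<alpha> * v y) * u y) x + f (u x) (v x) = 0) \<and>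
     (\<forall>x\<in>\<Omega>. laplacian (\<lambda>y. (d\<^sub>2 + \<beta> * u y) * v y) x + g (u x) (v x) = 0) \<and>
     (\<exists>G. C1_closure_gradient \<Omega> u G \<and> neumann_condition \<Omega> G) \<and>
     (\<exists>G. C1_closure_gradient \<Omega> v G \<and> neumann_condition \<Omega> G)"

definition positive_pair :: "'a set \<Rightarrow> ('a \<Rightarrow> real) \<Rightarrow> ('a \<Rightarrow> real) \<Rightarrow> bool" where
  "positive_pair \<Omega> u v \<longleftrightarrow> (\<forall>x\<in>\<Omega>. u x > 0 \<and> v x > 0)"

definition nonconstant_pair :: "'a set \<Rightarrow> ('a \<Rightarrow> real) \<Rightarrow> ('a \<Rightarrow> real) \<Rightarrow> bool" where
  "nonconstant_pair \<Omega> u v \<longleftrightarrow> \<not> (u constant_on \<Omega> \<and> v constant_on \<Omega>)"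

definition sign_changing :: "'a set \<Rightarrow> ('a \<Rightarrow> real) \<Rightarrow> bool" where
  "sign_changing \<Omega> w \<longleftrightarrow> (\<exists>x\<in>\<Omega>. w x > 0) \<and> (\<exists>x\<in>\<Omega>. w x < 0)"

definition pos_part :: "real \<Rightarrow> real" where
  "pos_part r = max r 0"

definition neg_part :: "real \<Rightarrow> real" where
  "neg_part r = - min r 0"

end

theory Submission
  imports Defs
begin

text \<open>
  The contradiction lies in the limiting problem itself: the equation for \<open>w\<close> and the integral
  constraint on \<open>f\<close> exclude a change of sign. Where \<open>w > 0\<close> the equation reads
  \<open>d \<Delta>w + f(w/\<delta>, 0) = 0\<close>, so for a regular level \<open>s > 0\<close> the divergence theorem and the Neumann condition give
  \<open>d \<integral>\<^bsub>{w = s}\<^esub> |\<nabla>w| = \<integral>\<^bsub>{w > s}\<^esub> f(w/\<delta>, 0)\<close>: the flux through a level surface is nonnegative. As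
  the total integral of \<open>f\<close> vanishes, this flux equals minus the integral of \<open>f\<close> over \<open>{0 < w < s}\<close>.
  For \<open>s \<le> \<eta> = \<delta> a\<^sub>1 / b\<^sub>1\<close> the reaction is positive there, so this set must be empty, whereas a
  sign-changing continuous function on a connected set takes all small positive values.

  Averaging over the levels avoids level surfaces altogether. Testing the weak equation
  with \<open>(w\<^sub>+)\<^sup>2\<close>, which is of class $C^1$ although \<open>w\<^sub>+\<close> is not, yields
  \<open>2 d \<integral> w\<^sub>+ |\<nabla>w|\<^sup>2 = \<integral> f (w\<^sub>+)\<^sup>2 = \<integral> f ((w\<^sub>+)\<^sup>2 - \<eta>\<^sup>2)\<close>,
  the last step because \<open>\<integral> f = 0\<close>. The left-hand side is nonnegative. On the right, \<open>f\<close> has the sign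
  of \<open>\<eta> - w\<close> on \<open>{w > 0}\<close> and vanishes elsewhere, so the integrand is nonpositive, and negative
  where \<open>0 < w < \<eta>\<close>.
\<close>

lemma DERIV_pos_part_square:
  "((\<lambda>r. (pos_part r)\<^sup>2) has_real_derivative 2 * pos_part s) (at s)"
proof (cases "s = 0")
  case False
  show ?thesis
  proof (cases "s > 0")
    case True
    have "((\<lambda>r. r\<^sup>2) has_real_derivative 2 * pos_part s) (at s)"
      using True by (auto intro!: derivative_eq_intros simp: pos_part_def)
    then show ?thesis
      by (rule has_field_derivative_transform_within_open[of _ _ _ "{0<..}"])
        (use True in \<open>auto simp: pos_part_def\<close>)
  next
    case False
    have "((\<lambda>r. 0) has_real_derivative 2 * pos_part s) (at s)"
      using False by (auto simp: pos_part_def)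
    then show ?thesis
      by (rule has_field_derivative_transform_within_open[of _ _ _ "{..<0}"])
        (use False \<open>s \<noteq> 0\<close> in \<open>auto simp: pos_part_def\<close>)
  qed
next
  case True
  \<comment> \<open>At the kink of \<open>pos_part\<close> the difference quotient is itself bounded by \<open>|h|\<close>.\<close>
  have "((\<lambda>h. (pos_part h)\<^sup>2 / h) \<longlongrightarrow> 0) (at 0)"
  proof (rule Lim_null_comparison[where g = "\<lambda>h. \<bar>h\<bar>"])
    show "\<forall>\<^sub>F h in at 0. norm ((pos_part h)\<^sup>2 / h) \<le> \<bar>h\<bar>"
      by (rule always_eventually) (auto simp: pos_part_def max_def power2_eq_square)
    show "((\<lambda>h::real. \<bar>h\<bar>) \<longlongrightarrow> 0) (at 0)"
      by (rule tendsto_eq_intros refl | simp)+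
  qed
  then show ?thesis
    using True by (simp add: DERIV_def pos_part_def)
qed

lemma continuous_on_pos_part [continuous_intros]:
  "continuous_on S h \<Longrightarrow> continuous_on S (\<lambda>x. pos_part (h x))"
  unfolding pos_part_def by (intro continuous_intros)

lemma C1_closure_gradient_pos_part_square:
  assumes "C1_closure_gradient \<Omega> h G"
  shows "C1_closure_gradient \<Omega> (\<lambda>x. (pos_part (h x))\<^sup>2) (\<lambda>x. (2 * pos_part (h x)) *\<^sub>R G x)"
  using assms unfolding C1_closure_gradient_def
  by (auto intro!: continuous_intros
      GDERIV_DERIV_compose[where g = "\<lambda>r. (pos_part r)\<^sup>2", OF _ DERIV_pos_part_square])

lemma set_integrable_continuous_on_closure:
  fixes q :: "'a::euclidean_space \<Rightarrow> real"
  assumes "open S" "bounded S" "continuous_on (closure S) q"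
  shows "set_integrable lborel S q"
proof (rule set_integrable_subset)
  show "set_integrable lborel (closure S) q"
    unfolding set_integrable_def
    using borel_integrable_compact[of "closure S" q] assms
    by (simp add: indicator_def if_distrib cong: if_cong)
qed (use assms closure_subset in auto)

lemma set_integral_pos_of_continuous:
  fixes q :: "'a::euclidean_space \<Rightarrow> real"
  assumes "open S" "set_integrable lborel S q" "continuous_on S q"
    and nonneg: "\<And>x. x \<in> S \<Longrightarrow> q x \<ge> 0"
    and "x0 \<in> S" "q x0 > 0"
  shows "(LINT x:S|lborel. q x) > 0"
proof -
  let ?h = "\<lambda>x. indicator S x *\<^sub>R q x"
  let ?U = "S \<inter> q -` {0<..}"
  have ge: "(LINT x:S|lborel. q x) \<ge> 0"
    using nonneg unfolding set_lebesgue_integral_def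
    by (intro Bochner_Integration.integral_nonneg) (auto simp: indicator_def)
  have "(LINT x:S|lborel. q x) \<noteq> 0"
  proof
    assume "(LINT x:S|lborel. q x) = 0"
    then have "AE x in lborel. ?h x = 0"
      using integral_nonneg_eq_0_iff_AE[of lborel ?h] assms(2) nonneg
      by (auto simp: set_lebesgue_integral_def set_integrable_def indicator_def)
    then have "AE x in lebesgue. ?h x = 0"
      by (rule AE_completion)
    then have "AE x in lebesgue. x \<notin> ?U"
      by eventually_elim (auto simp: indicator_def split: if_splits)
    moreover have U: "open ?U"
      using assms(1,3) by (intro continuous_open_preimage) auto
    ultimately have "negligible ?U"
      by (simp add: AE_iff_null_sets negligible_iff_null_sets)
    with U have "?U = {}"
      using open_not_negligible by blast
    with assms(5,6) show False by auto
  qed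
  with ge show ?thesis by simp
qed

text \<open>The function \<open>k\<close> plays the part of the reaction \<open>f(\<cdot>/\<delta>, 0)\<close>, which is positive below its
  zero \<open>\<eta>\<close> and nonpositive above. The source \<open>F\<close> is tied to \<open>k\<close> only where \<open>w > 0\<close>,
  because the test function \<open>(w\<^sub>+)\<^sup>2\<close> vanishes elsewhere; this is how the term in \<open>g\<close>, which
  lives on \<open>{w < 0}\<close>, drops out.\<close>

lemma weak_neumann_solution_not_sign_changing:
  fixes \<Omega> :: "'a::euclidean_space set"
  assumes "open \<Omega>" "connected \<Omega>" "bounded \<Omega>" "d > 0" "\<eta> > 0"
    and k_cont: "continuous_on UNIV k" and k_zero: "k 0 = 0"
    and k_pos: "\<And>s. 0 < s \<Longrightarrow> s < \<eta> \<Longrightarrow> k s > 0"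
    and k_neg: "\<And>s. \<eta> \<le> s \<Longrightarrow> k s \<le> 0"
    and F: "\<And>x. x \<in> \<Omega> \<Longrightarrow> w x > 0 \<Longrightarrow> F x = k (w x)"
    and weak: "weak_neumann_solution \<Omega> d F w"
    and int0: "(LINT x:\<Omega>|lborel. k (pos_part (w x))) = 0"
  shows "\<not> sign_changing \<Omega> w"
proof
  assume "sign_changing \<Omega> w"
  then obtain x y where xy: "x \<in> \<Omega>" "w x > 0" "y \<in> \<Omega>" "w y < 0"
    unfolding sign_changing_def by blast
  obtain G where G: "C1_closure_gradient \<Omega> w G"
    and test: "\<And>\<phi> \<Phi>. C1_closure_gradient \<Omega> \<phi> \<Phi> \<Longrightarrow>
      d * (LINT x:\<Omega>|lborel. G x \<bullet> \<Phi> x) = (LINT x:\<Omega>|lborel. F x * \<phi> x)"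
    using weak unfolding weak_neumann_solution_def by blast
  have cw: "continuous_on (closure \<Omega>) w"
    using G by (simp add: C1_closure_gradient_def)
  let ?p = "\<lambda>x. pos_part (w x)"
  let ?q = "\<lambda>x. k (?p x) * (\<eta>\<^sup>2 - (?p x)\<^sup>2)"
  have ck: "continuous_on (closure \<Omega>) (\<lambda>x. k (?p x))"
    by (rule continuous_on_compose2[OF k_cont]) (auto intro!: continuous_intros cw)
  have cq: "continuous_on (closure \<Omega>) ?q"
    by (intro continuous_intros ck cw)
  have q_nonneg: "?q x \<ge> 0" for x
  proof -
    consider "?p x = 0" | "0 < ?p x" "?p x < \<eta>" | "\<eta> \<le> ?p x"
      by (force simp: pos_part_def)
    then show ?thesis
    proof cases
      case 2
      then show ?thesis
        using k_pos[of "?p x"] power_strict_mono[of "?p x" \<eta> 2] by simp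
    next
      case 3
      then show ?thesis
        using k_neg[of "?p x"] power_mono[of \<eta> "?p x" 2] \<open>\<eta> > 0\<close>
        by (simp add: mult_nonpos_nonpos)
    qed (simp add: k_zero)
  qed

  have "0 \<le> d * (LINT x:\<Omega>|lborel. G x \<bullet> ((2 * ?p x) *\<^sub>R G x))"
    using \<open>d > 0\<close> unfolding set_lebesgue_integral_def
    by (intro mult_nonneg_nonneg Bochner_Integration.integral_nonneg)
      (auto simp: indicator_def pos_part_def)
  also have "\<dots> = (LINT x:\<Omega>|lborel. F x * (?p x)\<^sup>2)"
    by (rule test[OF C1_closure_gradient_pos_part_square[OF G]])
  also have "\<dots> = (LINT x:\<Omega>|lborel. \<eta>\<^sup>2 * k (?p x) - ?q x)"
    using \<open>open \<Omega>\<close> F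
    by (intro set_lebesgue_integral_cong) (auto simp: pos_part_def max_def k_zero algebra_simps)
  also have "\<dots> = \<eta>\<^sup>2 * (LINT x:\<Omega>|lborel. k (?p x)) - (LINT x:\<Omega>|lborel. ?q x)"
    using set_integrable_continuous_on_closure[OF \<open>open \<Omega>\<close> \<open>bounded \<Omega>\<close> ck]
      set_integrable_continuous_on_closure[OF \<open>open \<Omega>\<close> \<open>bounded \<Omega>\<close> cq]
    by (subst set_integral_diff(2)) (auto simp: mult.commute[of "\<eta>\<^sup>2"])
  finally have "(LINT x:\<Omega>|lborel. ?q x) \<le> 0"
    by (simp add: int0)

  moreover obtain z where z: "z \<in> \<Omega>" "0 < w z" "w z < \<eta>"
  proof -
    have conn: "connected (w ` \<Omega>)"
      using \<open>connected \<Omega>\<close> cw closure_subset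
      by (intro connected_continuous_image) (auto intro: continuous_on_subset)
    have "min (w x) (\<eta> / 2) \<in> w ` \<Omega>"
      by (rule connectedD_interval[OF conn, of "w y" "w x"]) (use xy \<open>\<eta> > 0\<close> in auto)
    then obtain z where "z \<in> \<Omega>" "w z = min (w x) (\<eta> / 2)"
      by auto
    with that[of z] xy \<open>\<eta> > 0\<close> show ?thesis
      by (auto simp: min_def split: if_splits)
  qed
  have "?q z > 0"
    using z k_pos[of "w z"] power_strict_mono[of "w z" \<eta> 2] by (simp add: pos_part_def)
  then have "(LINT x:\<Omega>|lborel. ?q x) > 0"
    using z q_nonneg set_integrable_continuous_on_closure[OF \<open>open \<Omega>\<close> \<open>bounded \<Omega>\<close> cq]
      continuous_on_subset[OF cq closure_subset] \<open>open \<Omega>\<close>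
    by (intro set_integral_pos_of_continuous[of \<Omega> ?q z]) auto
  ultimately show False by simp
qed

theorem corollary2p3:
  fixes \<Omega> :: "'a::euclidean_space set"
    and d\<^sub>1 d\<^sub>2 a\<^sub>1 a\<^sub>2 b\<^sub>1 b\<^sub>2 c\<^sub>1 c\<^sub>2 \<delta> d \<gamma> :: real
    and f g :: "real \<Rightarrow> real \<Rightarrow> real"
    and \<alpha> \<beta> :: "nat \<Rightarrow> real"
    and us vs :: "nat \<Rightarrow> 'a \<Rightarrow> real"
    and r :: "nat \<Rightarrow> nat"
  assumes "bounded_smooth_domain \<Omega>"
    and "d\<^sub>1 > 0" "d\<^sub>2 > 0"
    and "a\<^sub>1 > 0" "b\<^sub>1 > 0" "c\<^sub>1 > 0" "a\<^sub>2 > 0" "b\<^sub>2 > 0" "c\<^sub>2 > 0"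
    and "a\<^sub>1 / a\<^sub>2 \<noteq> b\<^sub>1 / b\<^sub>2" "a\<^sub>1 / a\<^sub>2 \<noteq> c\<^sub>1 / c\<^sub>2"
    and "\<delta> = d\<^sub>1 / d\<^sub>2" "d = d\<^sub>2"
    and "f = reaction_f a\<^sub>1 b\<^sub>1 c\<^sub>1" "g = reaction_g a\<^sub>2 b\<^sub>2 c\<^sub>2"
    and "filterlim \<alpha> at_top sequentially" "filterlim \<beta> at_top sequentially"
    and "\<gamma> > 0" "(\<lambda>n. \<alpha> n / \<beta> n) \<longlonglongrightarrow> \<gamma>"
    and "\<And>n. cross_diffusion_solution \<Omega> d\<^sub>1 d\<^sub>2 (\<alpha> n) (\<beta> n) f g (us n) (vs n)"
    and "\<And>n. positive_pair \<Omega> (us n) (vs n)"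
    and "\<And>n. nonconstant_pair \<Omega> (us n) (vs n)"
    and "strict_mono r"
  shows "\<not> (\<exists>u v w.
      continuous_on (closure \<Omega>) u \<and> continuous_on (closure \<Omega>) v \<and>
      (\<forall>x\<in>closure \<Omega>. u x \<ge> 0 \<and> v x \<ge> 0) \<and>
      (\<forall>x\<in>\<Omega>. u x * v x = 0) \<and>
      uniform_limit (closure \<Omega>) (\<lambda>n. us (r n)) u sequentially \<and>
      uniform_limit (closure \<Omega>) (\<lambda>n. vs (r n)) v sequentially \<and>
      C1_closure_limit \<Omega> (\<lambda>n x. \<delta> * us (r n) x - \<gamma> * vs (r n) x) w \<and>
      sign_changing \<Omega> w \<and>
      weak_neumann_solution \<Omega> d
        (\<lambda>x. f (pos_part (w x) / \<delta>) (neg_part (w x) / \<gamma>)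
           - \<gamma> * g (pos_part (w x) / \<delta>) (neg_part (w x) / \<gamma>)) w \<and>
      (LINT x:\<Omega>|lborel. f (pos_part (w x) / \<delta>) (neg_part (w x) / \<gamma>)) = 0 \<and>
      (\<forall>x\<in>closure \<Omega>. u x = pos_part (w x) / \<delta> \<and> v x = neg_part (w x) / \<gamma>))"
proof (rule notI, elim exE conjE)
  fix w :: "'a \<Rightarrow> real"
  let ?f = "\<lambda>x. f (pos_part (w x) / \<delta>) (neg_part (w x) / \<gamma>)"
  let ?g = "\<lambda>x. g (pos_part (w x) / \<delta>) (neg_part (w x) / \<gamma>)"
  let ?k = "\<lambda>s. f (s / \<delta>) 0"
  assume sign: "sign_changing \<Omega> w"
    and weak: "weak_neumann_solution \<Omega> d (\<lambda>x. ?f x - \<gamma> * ?g x) w"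
    and int0: "(LINT x:\<Omega>|lborel. ?f x) = 0"
  have \<delta>: "\<delta> > 0"
    using assms(2,3,12) by simp
  have fk: "?f x = ?k (pos_part (w x))" for x
    using assms(14) by (simp add: reaction_f_def pos_part_def neg_part_def max_def min_def)
  have k: "?k s = s / \<delta> * (b\<^sub>1 / \<delta>) * (\<delta> * a\<^sub>1 / b\<^sub>1 - s)" for s
    using assms(5,14) \<delta> by (simp add: reaction_f_def field_simps)
  have "\<not> sign_changing \<Omega> w"
  proof (rule weak_neumann_solution_not_sign_changing[where k = ?k and \<eta> = "\<delta> * a\<^sub>1 / b\<^sub>1",
        OF _ _ _ _ _ _ _ _ _ _ weak])
    show "open \<Omega>" "connected \<Omega>" "bounded \<Omega>"
      using assms(1) by (auto simp: bounded_smooth_domain_def)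
    show "d > 0" "\<delta> * a\<^sub>1 / b\<^sub>1 > 0"
      using assms(3,4,5,13) \<delta> by auto
    show "continuous_on UNIV ?k"
      unfolding k by (intro continuous_intros) (use \<delta> assms(5) in auto)
    show "?k 0 = 0"
      by (simp add: assms(14) reaction_f_def)
    show "?k s > 0" if "0 < s" "s < \<delta> * a\<^sub>1 / b\<^sub>1" for s
      unfolding k using that \<delta> assms(5) by (intro mult_pos_pos divide_pos_pos) auto
    show "?k s \<le> 0" if "\<delta> * a\<^sub>1 / b\<^sub>1 \<le> s" for s
    proof -
      have "s \<ge> 0"
        using that \<delta> assms(4,5) by (meson divide_nonneg_pos less_imp_le mult_nonneg_nonneg order_trans)
      then show ?thesis
        unfolding k using that \<delta> assms(5) by (intro mult_nonneg_nonpos mult_nonneg_nonneg) auto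
    qed
    show "?f x - \<gamma> * ?g x = ?k (w x)" if "w x > 0" for x
      using that assms(15) by (simp add: reaction_g_def pos_part_def neg_part_def)
    show "(LINT x:\<Omega>|lborel. ?k (pos_part (w x))) = 0"
      using int0 by (simp add: fk)
  qed
  with sign show False by contradiction
qed

end
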